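(* Let $n\ge 1$ be an integer. The characteristic polynomial $P_n(\lambda)=\det(\lambda I-A)$ of the adjacency matrix $A$ of the star semigraph $S^3_n$ is $$P_n(\lambda)=(\lambda+2)(\lambda^2-4)^{n-1}\left[\lambda^2-2\lambda-2n\right].$$
   Context: A semigraph is a pair $G=(V,E)$, where $V$ is a non-empty finite set (vertices) and $E$ is a set of ordered $k$-tuples ($k\ge 2$, $k$ may vary) of distinct vertices (edges), such that any two distinct edges have at most one vertex in common; an edge $(u_1,\dots,u_k)$ is identified with its reversal $(u_k,\dots,u_1)$. For an edge $(u_1,\dots,u_k)$, $u_1,u_k$ are its end vertices and $u_2,\dots,u_{k-1}$ its middle vertices. A vertex is a pure end vertex if it is an end vertex of every edge containing it; a pure middle vertex if it is a middle vertex of every edge containing it; a middle end vertex if it is a middle vertex of at least one edge and an end vertex of at least one other edge. An edge $(u_1,\dots,u_k)$, $k\ge2$, is a full edge if $u_1,u_k$ are pure end vertices. An edge with $k>2$ is a half edge if at least one of $u_1,u_k$ is a middle end vertex. An edge $(u_1,u_2)$ with two vertices is a quarter edge if both are middle end vertices, and a half edge if exactly one is a middle end vertex and the other is a pure end vertex. For a half edge $(u_1,\dots,u_k)$ with $k>2$, the pair $(u_1,u_2)$ is a partial half edge if $u_1$ is a middle end vertex, and $(u_{k-1},u_k)$ is a partial half edge if $u_k$ is a middle end vertex; a half edge with two vertices is itself a partial half edge. For vertices $u_i,u_j$ of an edge $e=(u_1,\dots,u_k)$ put $d_e(u_i,u_j)=|i-j|$. The adjacency matrix of a semigraph with vertex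 set indexed as $v_i$ is the symmetric matrix $A=(a_{ij})$ with: $a_{ij}=d_e(v_i,v_j)$ if $v_i\neq v_j$ belong to a full edge or half edge $e$ and $(v_i,v_j)$ is neither a partial half edge nor a quarter edge; $a_{ij}=\frac12$ if $(v_i,v_j)$ is a partial half edge; $a_{ij}=\frac14$ if $(v_i,v_j)$ is a quarter edge; $a_{ij}=0$ otherwise. The star semigraph $S^3_n$ has vertices $v_0,v_1,\dots,v_{2n}$ and the $n$ edges $(v_{2i-1},v_0,v_{2i})$, $1\le i\le n$, all with three vertices and sharing the common middle vertex $v_0$. Its adjacency matrix is the symmetric $(2n+1)\times(2n+1)$ matrix with rows and columns indexed by $0,1,\dots,2n$, with $a_{0j}=1$ for $1\le j\le 2n$, $a_{2i-1,2i}=2$ for $1\le i\le n$, and all other entries on or above the diagonal equal to $0$. *)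

theory Defs
  imports Complex_Main "Jordan_Normal_Form.Char_Poly"
begin

text \<open>
  An edge is the list of its vertices in order. An edge and its reversal are identified, so an
  edge is given by one of its two orientations; since any two members of \<open>edges\<close> share at most
  one vertex, an edge is never listed in both orientations. All notions below are invariant
  under reversing an edge.
\<close>

record 'a pre_semigraph =
  verts :: "'a set"
  edges :: "'a list set"

locale semigraph =
  fixes G :: "'a pre_semigraph"
  assumes finite_verts: "finite (verts G)"
    and verts_nonempty: "verts G \<noteq> {}"
    and edge_verts: "e \<in> edges G \<Longrightarrow> set e \<subseteq> verts G"
    and edge_length: "e \<in> edges G \<Longrightarrow> 2 \<le> length e"
    and edge_distinct: "e \<in> edges G \<Longrightarrow> distinct e"
    and edges_inter: "e \<in> edges G \<Longrightarrow> f \<in> edges G \<Longrightarrow> e \<noteq> f \<Longrightarrow> card (set e \<inter> set f) \<le> 1"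

definition end_vertex_of :: "'a list \<Rightarrow> 'a \<Rightarrow> bool" where
  "end_vertex_of e u \<longleftrightarrow> u = hd e \<or> u = last e"

definition middle_vertex_of :: "'a list \<Rightarrow> 'a \<Rightarrow> bool" where
  "middle_vertex_of e u \<longleftrightarrow> u \<in> set (butlast (tl e))"

definition pure_end_vertex :: "'a pre_semigraph \<Rightarrow> 'a \<Rightarrow> bool" where
  "pure_end_vertex G u \<longleftrightarrow>
     u \<in> verts G \<and> (\<forall>e\<in>edges G. u \<in> set e \<longrightarrow> end_vertex_of e u)"

definition middle_end_vertex :: "'a pre_semigraph \<Rightarrow> 'a \<Rightarrow> bool" where
  "middle_end_vertex G u \<longleftrightarrow>
     u \<in> verts G \<and>
     (\<exists>e\<in>edges G. \<exists>f\<in>edges G. e \<noteq> f \<and> middle_vertex_of e u \<and> end_vertex_of f u)"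

definition full_edge :: "'a pre_semigraph \<Rightarrow> 'a list \<Rightarrow> bool" where
  "full_edge G e \<longleftrightarrow>
     e \<in> edges G \<and> pure_end_vertex G (hd e) \<and> pure_end_vertex G (last e)"

definition half_edge :: "'a pre_semigraph \<Rightarrow> 'a list \<Rightarrow> bool" where
  "half_edge G e \<longleftrightarrow>
     e \<in> edges G \<and>
     (if length e = 2
      then middle_end_vertex G (hd e) \<and> pure_end_vertex G (last e) \<or>
           pure_end_vertex G (hd e) \<and> middle_end_vertex G (last e)
      else middle_end_vertex G (hd e) \<or> middle_end_vertex G (last e))"

definition quarter_edge :: "'a pre_semigraph \<Rightarrow> 'a list \<Rightarrow> bool" where
  "quarter_edge G e \<longleftrightarrow>
     e \<in> edges G \<and> length e = 2 \<and> middle_end_vertex G (hd e) \<and> middle_end_vertex G (last e)"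

text \<open>The next two predicates concern unordered pairs of vertices.\<close>

definition partial_half_edge :: "'a pre_semigraph \<Rightarrow> 'a \<Rightarrow> 'a \<Rightarrow> bool" where
  "partial_half_edge G u w \<longleftrightarrow>
     (\<exists>e. half_edge G e \<and>
        (if length e = 2 then {u, w} = set e
         else middle_end_vertex G (hd e) \<and> {u, w} = {hd e, e ! 1} \<or>
              middle_end_vertex G (last e) \<and> {u, w} = {e ! (length e - 2), last e}))"

definition quarter_edge_pair :: "'a pre_semigraph \<Rightarrow> 'a \<Rightarrow> 'a \<Rightarrow> bool" where
  "quarter_edge_pair G u w \<longleftrightarrow> (\<exists>e. quarter_edge G e \<and> {u, w} = set e)"

definition position :: "'a list \<Rightarrow> 'a \<Rightarrow> nat" where
  "position e u = length (takeWhile (\<lambda>x. x \<noteq> u) e)"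

definition edge_dist :: "'a list \<Rightarrow> 'a \<Rightarrow> 'a \<Rightarrow> real" where
  "edge_dist e u w = \<bar>real (position e u) - real (position e w)\<bar>"

text \<open>
  In a semigraph two distinct vertices lie on at most one common edge, so the description
  below picks out the edge \<open>e\<close> for which the entry is \<open>d\<^sub>e(u, w)\<close>.
\<close>

definition adjacency_entry :: "'a pre_semigraph \<Rightarrow> 'a \<Rightarrow> 'a \<Rightarrow> real" where
  "adjacency_entry G u w =
     (if partial_half_edge G u w then 1 / 2
      else if quarter_edge_pair G u w then 1 / 4
      else if u \<noteq> w \<and> (\<exists>e. (full_edge G e \<or> half_edge G e) \<and> u \<in> set e \<and> w \<in> set e)
      then edge_dist (THE e. (full_edge G e \<or> half_edge G e) \<and> u \<in> set e \<and> w \<in> set e) u w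
      else 0)"

text \<open>The list \<open>vs\<close> is meant to enumerate the vertices without repetition.\<close>

definition adjacency_matrix :: "'a pre_semigraph \<Rightarrow> 'a list \<Rightarrow> real mat" where
  "adjacency_matrix G vs =
     mat (length vs) (length vs) (\<lambda>(i, j). adjacency_entry G (vs ! i) (vs ! j))"

text \<open>The star semigraph \<open>S\<^sup>3\<^sub>n\<close>, with the vertex \<open>v\<^sub>j\<close> represented by the number \<open>j\<close>.\<close>

definition star_semigraph :: "nat \<Rightarrow> nat pre_semigraph" where
  "star_semigraph n =
     \<lparr>verts = {0..2 * n}, edges = (\<lambda>i. [2 * i - 1, 0, 2 * i]) ` {1..n}\<rparr>"

lemma semigraph_star_semigraph: "semigraph (star_semigraph n)"
proof
  fix e f :: "nat list"
  assume "e \<in> edges (star_semigraph n)" "f \<in> edges (star_semigraph n)" and ne: "e \<noteq> f"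
  then obtain i j where e: "e = [2 * i - 1, 0, 2 * i]" and f: "f = [2 * j - 1, 0, 2 * j]"
    and ij: "1 \<le> i" "1 \<le> j"
    unfolding star_semigraph_def by force
  have "i \<noteq> j"
    using ne e f by blast
  then have "set e \<inter> set f \<subseteq> {0}"
    using ij unfolding e f by auto
  then show "card (set e \<inter> set f) \<le> 1"
    using card_mono[of "{0::nat}"] by fastforce
qed (auto simp: star_semigraph_def)

lemma full_edge_star_semigraph: "full_edge (star_semigraph n) e \<longleftrightarrow> e \<in> edges (star_semigraph n)"
  unfolding full_edge_def pure_end_vertex_def end_vertex_of_def star_semigraph_def
  by auto

lemma not_middle_end_vertex_star_semigraph: "\<not> middle_end_vertex (star_semigraph n) u"
  unfolding middle_end_vertex_def middle_vertex_of_def end_vertex_of_def star_semigraph_def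
  by auto

lemma adjacency_entry_star_semigraph:
  assumes "i < j" "j \<le> 2 * n"
  shows "adjacency_entry (star_semigraph n) i j =
    (if i = 0 then 1 else if odd i \<and> j = i + 1 then 2 else 0)"
proof -
  let ?P = "\<lambda>e. e \<in> edges (star_semigraph n) \<and> i \<in> set e \<and> j \<in> set e"
  have half: "\<not> half_edge (star_semigraph n) e" for e
    by (simp add: half_edge_def not_middle_end_vertex_star_semigraph)
  have entry: "adjacency_entry (star_semigraph n) i j =
      (if \<exists>e. ?P e then edge_dist (THE e. ?P e) i j else 0)"
    using assms
    by (auto simp: adjacency_entry_def partial_half_edge_def quarter_edge_pair_def quarter_edge_def
        half not_middle_end_vertex_star_semigraph full_edge_star_semigraph)
  have uniq: "(THE e. ?P e) = e" if "?P e" for e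
  proof (rule the_equality)
    fix f assume f: "?P f"
    interpret semigraph "star_semigraph n"
      by (rule semigraph_star_semigraph)
    have "card {i, j} \<le> card (set e \<inter> set f)"
      using that f by (intro card_mono) auto
    then show "f = e"
      using edges_inter[of e f] that f \<open>i < j\<close> by fastforce
  qed (fact that)
  have entry_eq: "adjacency_entry (star_semigraph n) i j = edge_dist e i j" if "?P e" for e
    unfolding entry uniq[OF that] using that by meson
  define k where "k = (j + 1) div 2"
  define e where "e = [2 * k - 1, 0, 2 * k]"
  have k: "1 \<le> k" "k \<le> n" "j = 2 * k \<or> j = 2 * k - 1"
    using assms unfolding k_def by presburger+
  have e: "e \<in> edges (star_semigraph n)"
    using k by (auto simp: e_def star_semigraph_def)
  consider "i = 0" | "odd i" "j = i + 1" | "i \<noteq> 0" "\<not> (odd i \<and> j = i + 1)"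
    by blast
  then show ?thesis
  proof cases
    case 1
    then have P: "?P e"
      using k e by (auto simp: e_def)
    then show ?thesis
      unfolding entry_eq[OF P] using k 1 by (auto simp: edge_dist_def position_def e_def)
  next
    case 2
    then have i: "i = 2 * k - 1" "j = 2 * k"
      using k by presburger+
    then have P: "?P e"
      using e by (auto simp: e_def)
    then show ?thesis
      unfolding entry_eq[OF P] using k 2 i by (auto simp: edge_dist_def position_def e_def)
  next
    case 3
    have "\<not> ?P f" for f
    proof
      assume "?P f"
      then obtain m where "1 \<le> m" "i \<in> {2 * m - 1, 0, 2 * m}" "j \<in> {2 * m - 1, 0, 2 * m}"
        by (auto simp: star_semigraph_def)
      then have "i = 2 * m - 1" "j = 2 * m"
        using 3 \<open>i < j\<close> by auto
      with 3 \<open>1 \<le> m\<close> show False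
        by auto
    qed
    then show ?thesis
      using 3 by (subst entry) auto
  qed
qed

end

theory Submission
  imports Defs
begin

text \<open>
  Let \<open>M = \<lambda>I - A\<close>. Every row of \<open>M\<close> other than row \<open>0\<close> has the entry \<open>-1\<close> in column \<open>0\<close> and
  the remaining entries sum to \<open>\<lambda> - 2\<close>, so replacing column \<open>0\<close> by \<open>\<lambda> - 2\<close> times itself plus all
  other columns leaves only the entry \<open>\<lambda>\<^sup>2 - 2\<lambda> - 2n\<close> in it. Replacing each column \<open>2i - 1\<close> by
  \<open>\<lambda>\<close> times itself plus twice column \<open>2i\<close> then makes the matrix upper triangular. These column
  operations are right multiplication by a lower triangular matrix, and comparing determinants gives
  \<open>P\<^sub>n(\<lambda>) (\<lambda> - 2) \<lambda>\<^sup>n = (\<lambda>\<^sup>2 - 2\<lambda> - 2n) (\<lambda>\<^sup>2 - 4)\<^sup>n \<lambda>\<^sup>n\<close>.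
\<close>

lemma adjacency_entry_commute: "adjacency_entry G u w = adjacency_entry G w u"
proof -
  have "partial_half_edge G u w = partial_half_edge G w u"
    "quarter_edge_pair G u w = quarter_edge_pair G w u"
    unfolding partial_half_edge_def quarter_edge_pair_def by (simp_all add: insert_commute)
  \<comment> \<open>Equality as functions makes the definite descriptions in both entries the same
    edge.\<close>
  moreover have "(\<lambda>e. (full_edge G e \<or> half_edge G e) \<and> u \<in> set e \<and> w \<in> set e) =
      (\<lambda>e. (full_edge G e \<or> half_edge G e) \<and> w \<in> set e \<and> u \<in> set e)"
    by auto
  moreover have "edge_dist e u w = edge_dist e w u" for e
    unfolding edge_dist_def by (rule abs_minus_commute)
  ultimately show ?thesis
    unfolding adjacency_entry_def by auto
qed

lemma adjacency_entry_star_semigraph_self: "adjacency_entry (star_semigraph n) i i = 0"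
  by (simp add: adjacency_entry_def partial_half_edge_def quarter_edge_pair_def quarter_edge_def
      half_edge_def not_middle_end_vertex_star_semigraph)

text \<open>For \<open>i\<close> \<ge> 1 this is the other end vertex of the edge through
  \<open>i\<close>.\<close>

definition star_partner :: "nat \<Rightarrow> nat" where
  "star_partner i = (if odd i then i + 1 else i - 1)"

lemma adjacency_entry_star_semigraph_partner:
  assumes "i \<le> 2 * n" "j \<le> 2 * n"
  shows "adjacency_entry (star_semigraph n) i j =
    (if i = j then 0 else if i = 0 \<or> j = 0 then 1 else if j = star_partner i then 2 else 0)"
proof (cases i j rule: linorder_cases)
  case less
  then show ?thesis
    using assms by (auto simp: adjacency_entry_star_semigraph star_partner_def)
next
  case equal
  then show ?thesis
    by (simp add: adjacency_entry_star_semigraph_self)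
next
  case greater
  then show ?thesis
    using assms
    by (subst adjacency_entry_commute) (auto simp: adjacency_entry_star_semigraph star_partner_def)
qed

definition star_char_entry :: "nat \<Rightarrow> nat \<Rightarrow> real poly" where
  "star_char_entry i j =
    (if i = j then [:0, 1:] else if i = 0 \<or> j = 0 then - 1
     else if j = star_partner i then - 2 else 0)"

lemma char_poly_matrix_star_semigraph:
  "char_poly_matrix (adjacency_matrix (star_semigraph n) [0..<2 * n + 1]) =
    mat (2 * n + 1) (2 * n + 1) (\<lambda>(i, j). star_char_entry i j)"
  by (rule eq_matI)
    (auto simp: char_poly_matrix_def adjacency_matrix_def star_char_entry_def
      adjacency_entry_star_semigraph_partner nth_append one_pCons numeral_poly
      simp del: upt_Suc)

text \<open>Column \<open>j\<close> lists the coefficients with which the old columns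
  \<open>k\<close> combine into the new column \<open>j\<close>.\<close>

definition star_column_op :: "nat \<Rightarrow> nat \<Rightarrow> real poly" where
  "star_column_op k j =
    (if j = 0 then if k = 0 then [:-2, 1:] else 1
     else if k = j then if odd j then [:0, 1:] else 1
     else if odd j \<and> k = j + 1 then 2 else 0)"

lemma sum_star_char_entry_row:
  assumes "1 \<le> i" "i \<le> 2 * n"
  shows "(\<Sum>k=1..2 * n. star_char_entry i k) = [:-2, 1:]"
proof -
  have p: "star_partner i \<noteq> i" "1 \<le> star_partner i" "star_partner i \<le> 2 * n"
    using assms unfolding star_partner_def by presburger+
  have "(\<Sum>k=1..2 * n. star_char_entry i k) = (\<Sum>k\<in>{i, star_partner i}. star_char_entry i k)"
    using assms p by (intro sum.mono_neutral_right) (auto simp: star_char_entry_def)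
  also have "\<dots> = [:-2, 1:]"
    using assms p by (auto simp: star_char_entry_def numeral_poly)
  finally show ?thesis .
qed

text \<open>Restricted to \<open>j\<close> \<le> \<open>i\<close>: this already gives triangularity
  and the diagonal, whereas row 0 has nonzero entries above it.\<close>

lemma star_reduced_entry:
  assumes "j \<le> i" "i \<le> 2 * n"
  shows "(\<Sum>k=0..<2 * n + 1. star_char_entry i k * star_column_op k j) =
    (if i \<noteq> j then 0 else if j = 0 then [:- 2 * real n, -2, 1:]
     else if odd j then [:-4, 0, 1:] else [:0, 1:])"
proof (cases "j = 0")
  case True
  have "{0..<2 * n + 1} = insert 0 {1..2 * n}"
    by auto
  then have "(\<Sum>k=0..<2 * n + 1. star_char_entry i k * star_column_op k j) =
      star_char_entry i 0 * [:-2, 1:] + (\<Sum>k=1..2 * n. star_char_entry i k)"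
    using True by (simp add: star_column_op_def)
  \<comment> \<open>Row 0 yields \<lambda>(\<lambda> - 2) - 2n; in any other row the entry -1
    contributes -(\<lambda> - 2), cancelling the sum.\<close>
  also have "\<dots> = (if i = 0 then [:- 2 * real n, -2, 1:] else 0)"
  proof (cases "i = 0")
    case True
    then have "(\<Sum>k=1..2 * n. star_char_entry i k) = [:- 2 * real n:]"
      by (simp add: star_char_entry_def of_nat_poly numeral_poly)
    then show ?thesis
      using True by (simp add: star_char_entry_def)
  next
    case False
    then have "(\<Sum>k=1..2 * n. star_char_entry i k) = [:-2, 1:]"
      using assms by (intro sum_star_char_entry_row) auto
    then show ?thesis
      using False by (simp add: star_char_entry_def)
  qed
  finally show ?thesis
    using True by simp
next
  case False
  show ?thesis
  proof (cases "odd j")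
    case True
    then have "j + 1 \<le> 2 * n"
      using assms by presburger
    then have "(\<Sum>k=0..<2 * n + 1. star_char_entry i k * star_column_op k j) =
        (\<Sum>k\<in>{j, j + 1}. star_char_entry i k * star_column_op k j)"
      using False by (intro sum.mono_neutral_right) (auto simp: star_column_op_def)
    also have "\<dots> = star_char_entry i j * [:0, 1:] + star_char_entry i (j + 1) * 2"
      using True False by (simp add: star_column_op_def)
    \<comment> \<open>Row \<open>j\<close> gives \<lambda>\<lambda> - 4, row \<open>j + 1\<close>
      gives -2\<lambda> + 2\<lambda>, and further down both entries vanish.\<close>
    also have "\<dots> = (if i = j then [:-4, 0, 1:] else 0)"
      using True False \<open>j \<le> i\<close>
      by (auto simp: star_char_entry_def star_partner_def numeral_poly) presburger
    finally show ?thesis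
      using True False by auto
  next
    case even: False
    have "(\<Sum>k=0..<2 * n + 1. star_char_entry i k * star_column_op k j) =
        (\<Sum>k\<in>{j}. star_char_entry i k * star_column_op k j)"
      using assms False even by (intro sum.mono_neutral_right) (auto simp: star_column_op_def)
    \<comment> \<open>The partner of an even \<open>j\<close> is \<open>j - 1\<close>, so its entry
      -2 lies above the diagonal.\<close>
    also have "\<dots> = (if i = j then [:0, 1:] else 0)"
      using even False \<open>j \<le> i\<close>
      by (auto simp: star_char_entry_def star_column_op_def star_partner_def)
    finally show ?thesis
      using even False by auto
  qed
qed

text \<open>Serves both diagonal products; each induction step adds one odd and one even
  index.\<close>

lemma prod_alternating:
  fixes a b c :: "'a :: comm_monoid_mult"
  shows "(\<Prod>i=0..<2 * n + 1. if i = 0 then a else if odd i then b else c) = a * (b * c) ^ n"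
  by (induction n) (simp_all add: ac_simps)

theorem lemma4p3:
  fixes n :: nat
  assumes "n \<ge> 1"
  shows "char_poly (adjacency_matrix (star_semigraph n) [0..<2 * n + 1]) =
    [:2, 1:] * [:-4, 0, 1:] ^ (n - 1) * [:- 2 * real n, -2, 1:]"
proof -
  define N where "N = 2 * n + 1"
  define M where "M = mat N N (\<lambda>(i, j). star_char_entry i j)"
  define L where "L = mat N N (\<lambda>(k, j). star_column_op k j)"
  have carrier: "M \<in> carrier_mat N N" "L \<in> carrier_mat N N"
    by (simp_all add: M_def L_def)
  have reduced: "(M * L) $$ (i, j) =
      (if i \<noteq> j then 0 else if j = 0 then [:- 2 * real n, -2, 1:]
       else if odd j then [:-4, 0, 1:] else [:0, 1:])" if "j \<le> i" "i < N" for i j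
  proof -
    have "(M * L) $$ (i, j) = (\<Sum>k=0..<N. star_char_entry i k * star_column_op k j)"
      using that by (simp add: M_def L_def scalar_prod_def)
    then show ?thesis
      unfolding N_def using that star_reduced_entry[of j i n] by (simp add: N_def)
  qed
  have "det L = (\<Prod>i=0..<N. L $$ (i, i))"
    using carrier
    by (subst det_lower_triangular[of N])
      (auto simp: prod_list_diag_prod L_def star_column_op_def)
  also have "\<dots> = (\<Prod>i=0..<N. if i = 0 then [:-2, 1:] else if odd i then [:0, 1:] else 1)"
    by (rule prod.cong) (auto simp: L_def star_column_op_def)
  finally have det_L: "det L = [:-2, 1:] * [:0, 1:] ^ n"
    unfolding N_def prod_alternating by simp
  have "upper_triangular (M * L)"
    using carrier by (intro upper_triangularI) (subst reduced, auto)
  then have "det (M * L) = (\<Prod>i=0..<N. (M * L) $$ (i, i))"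
    using carrier by (subst det_upper_triangular[of _ N]) (auto simp: prod_list_diag_prod)
  also have "\<dots> = (\<Prod>i=0..<N. if i = 0 then [:- 2 * real n, -2, 1:]
      else if odd i then [:-4, 0, 1:] else [:0, 1:])"
    by (rule prod.cong) (auto simp: reduced)
  finally have "det (M * L) = [:- 2 * real n, -2, 1:] * ([:-4, 0, 1:] * [:0, 1:]) ^ n"
    unfolding N_def prod_alternating .
  then have "det M * ([:-2, 1:] * [:0, 1:] ^ n) =
      [:- 2 * real n, -2, 1:] * [:-4, 0, 1:] ^ n * [:0, 1:] ^ n"
    using det_mult[OF carrier] det_L by (simp only: power_mult_distrib mult.assoc)
  \<comment> \<open>As \<open>n\<close> \<ge> 1, one factor \<lambda>^2 - 4 can be split off to
    expose the \<lambda> - 2 to be cancelled.\<close>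
  also have "[:-4, 0, 1:] ^ n = [:-4, 0, 1:] ^ (n - 1) * ([:2, 1:] * [:-2, 1:] :: real poly)"
    using assms by (cases n) simp_all
  finally have "det M * ([:-2, 1:] * [:0, 1:] ^ n) =
      ([:2, 1:] * [:-4, 0, 1:] ^ (n - 1) * [:- 2 * real n, -2, 1:]) * ([:-2, 1:] * [:0, 1:] ^ n)"
    by (simp only: ac_simps)
  \<comment> \<open>Cancellation takes place among polynomials, so the roots 0 and 2 of this factor
    do no harm.\<close>
  moreover have "[:-2, 1:] * [:0, 1:] ^ n \<noteq> (0 :: real poly)"
    unfolding mult_eq_0_iff power_eq_0_iff by simp
  ultimately have "det M = [:2, 1:] * [:-4, 0, 1:] ^ (n - 1) * [:- 2 * real n, -2, 1:]"
    by (metis mult_right_cancel)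
  then show ?thesis
    unfolding char_poly_def char_poly_matrix_star_semigraph M_def N_def .
qed

end
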